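(* Almost basic convergence is metrizable on $\mathcal{W}$. A metric is given by $$d(f,g)=\min\left\{\varepsilon\geq0:\ \exists c\in\mathbb{R}:\ \lambda\left(\left\{x\in\left[-\tfrac{1}{\varepsilon},\tfrac{1}{\varepsilon}\right]:|f(x)-c-g(x)|>\varepsilon\right\}\right)\leq\varepsilon\right\},\qquad f,g\in\mathcal{W},$$ with the convention $\left[-\tfrac{1}{0},\tfrac{1}{0}\right]:=\mathbb{R}$. That is, the minimum exists for all $f,g\in\mathcal{W}$, $d$ is a metric on $\mathcal{W}$, and for all $f_n,f\in\mathcal{W}$ ($n\in\mathbb{N}$), $d(f_n,f)\to0$ if and only if $f_n$ converges almost basically to $f$.
   Context: $\lambda$ is Lebesgue measure on $\mathbb{R}$. $\mathcal{W}$ is the set of right-continuous functions $f:\mathbb{R}\to\mathbb{R}$ of bounded variation (i.e. $\lim_{n\to\infty}TV_{[-n,n]}f<\infty$, where $TV_{[a,b]}f$ is the total variation of $f$ on $[a,b]$) with $\lim_{x\to-\infty}f(x)=0$. Functions $f_n:\mathbb{R}\to\mathbb{R}$ converge almost basically to $f:\mathbb{R}\to\mathbb{R}$ if every subsequence $(f_{n_k})_{k}$ contains a further subsequence $(f_{n_{k_l}})_{l}$ and there is a set $S\subset\mathbb{R}$ of Lebesgue measure zero (which may depend on the subsequence) such that $f_{n_{k_l}}(x_1)-f_{n_{k_l}}(x_2)\to f(x_1)-f(x_2)$ as $l\to\infty$ for all $x_1,x_2\in\mathbb{R}\setminus S$. *)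

theory Defs
  imports "HOL-Analysis.Analysis"
begin

text \<open>The supremum runs over the partitions \<open>a = x 0 < \<dots> < x n = b\<close>; it is used for \<open>a \<le> b\<close> only
  (for \<open>a = b\<close> the only partition has \<open>n = 0\<close>).\<close>
definition total_variation :: "real \<Rightarrow> real \<Rightarrow> (real \<Rightarrow> real) \<Rightarrow> ennreal" where
  "total_variation a b f =
     Sup {(\<Sum>i<n. ennreal \<bar>f (x (Suc i)) - f (x i)\<bar>) | n (x :: nat \<Rightarrow> real).
            x 0 = a \<and> x n = b \<and> (\<forall>i<n. x i < x (Suc i))}"

text \<open>The sequence in the second conjunct is nondecreasing in \<^typ>\<open>ennreal\<close>, so its limit always
  exists.\<close>
definition \<W> :: "(real \<Rightarrow> real) set" where
  "\<W> = {f. (\<forall>x. continuous (at_right x) f) \<and>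
            lim (\<lambda>n. total_variation (- real n) (real n) f) < \<infinity> \<and>
            (f \<longlongrightarrow> 0) at_bot}"

definition converges_almost_basically ::
    "(nat \<Rightarrow> real \<Rightarrow> real) \<Rightarrow> (real \<Rightarrow> real) \<Rightarrow> bool" where
  "converges_almost_basically F f \<longleftrightarrow>
     (\<forall>k :: nat \<Rightarrow> nat. strict_mono k \<longrightarrow>
       (\<exists>l :: nat \<Rightarrow> nat. strict_mono l \<and>
         (\<exists>S \<in> null_sets lebesgue. \<forall>x1 \<in> - S. \<forall>x2 \<in> - S.
           (\<lambda>i. F (k (l i)) x1 - F (k (l i)) x2) \<longlonglongrightarrow> f x1 - f x2)))"

text \<open>The case distinction implements the convention \<open>[-1/0, 1/0] = \<real>\<close>, since \<open>1 / 0 = 0\<close> in HOL.\<close>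
definition window :: "real \<Rightarrow> real set" where
  "window \<epsilon> = (if \<epsilon> = 0 then UNIV else {- (1 / \<epsilon>)..1 / \<epsilon>})"

definition admissible :: "(real \<Rightarrow> real) \<Rightarrow> (real \<Rightarrow> real) \<Rightarrow> real set" where
  "admissible f g =
     {\<epsilon>. 0 \<le> \<epsilon> \<and>
         (\<exists>c::real. emeasure lebesgue {x \<in> window \<epsilon>. \<bar>f x - c - g x\<bar> > \<epsilon>} \<le> ennreal \<epsilon>)}"

text \<open>Written as an infimum so that it is also nonnegative and symmetric outside \<open>\<W>\<close>, as the locale
  \<^locale>\<open>Metric_space\<close> demands; that the infimum is attained on \<open>\<W>\<close>, i.e. is a minimum, has to be
  asserted separately.\<close>
definition ab_dist :: "(real \<Rightarrow> real) \<Rightarrow> (real \<Rightarrow> real) \<Rightarrow> real" where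
  "ab_dist f g = Inf (admissible f g)"

end

theory Submission
  imports Defs
begin

text \<open>Right-continuity and the limit at \<open>-\<infinity>\<close> are what makes \<open>d f g = 0\<close> imply \<open>f = g\<close>; the rest is
  measure theory. The admissible radii form a closed set: take the limit of the constants \<open>c\<close>
  along a subsequence and apply Fatou; if the constants escape to infinity, the exceptional sets
  exhaust the window, so that any constant will do. Given \<open>d (f n) f \<longlonglongrightarrow> 0\<close>, Borel--Cantelli
  along a subsequence with \<open>d \<le> 1 / 2 ^ n\<close> gives \<open>f n x - c n \<longlonglongrightarrow> f x\<close> almost everywhere, and differences
  eliminate the \<open>c n\<close>. Conversely, fixing one good point \<open>z\<close> and \<open>c n = f n z - f z\<close> gives almost
  everywhere convergence, hence convergence in measure on every bounded window.\<close>

section \<open>Measurability of right-continuous functions\<close>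

text \<open>Sampling \<open>f\<close> at the right end of the grid cell of width
  \<open>1 / Suc n\<close> that contains \<open>x\<close> gives measurable step functions. They
  converge pointwise to \<open>f\<close> because the sample points approach \<open>x\<close> from
  the right.\<close>

lemma borel_measurable_if_right_continuous:
  fixes f :: "real \<Rightarrow> real"
  assumes "\<And>x. continuous (at_right x) f"
  shows "f \<in> borel_measurable borel"
proof -
  \<comment> \<open>Floor plus one, rather than the ceiling, keeps \<open>r n x\<close> strictly to
    the right of \<open>x\<close> even at grid points, as the filter \<open>at_right x\<close>
    demands.\<close>
  define r where "r n x = (of_int \<lfloor>x * real (Suc n)\<rfloor> + 1) / real (Suc n)" for n x
  show ?thesis
  proof (rule borel_measurable_LIMSEQ_real[where u = "\<lambda>n x. f (r n x)"])
    fix n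
    \<comment> \<open>The sampled function factors through the integer-valued floor, and every
      function on the discrete type \<open>int\<close> is measurable.\<close>
    have "(\<lambda>x. (\<lambda>k::int. f ((of_int k + 1) / real (Suc n))) \<lfloor>x * real (Suc n)\<rfloor>)
            \<in> borel_measurable borel"
      by measurable
    then show "(\<lambda>x. f (r n x)) \<in> borel_measurable borel"
      unfolding r_def .
  next
    fix x :: real
    have less: "x < r n x" and le: "r n x \<le> x + 1 / real (Suc n)" for n
    proof -
      have "x * real (Suc n) < of_int \<lfloor>x * real (Suc n)\<rfloor> + 1" by linarith
      then show "x < r n x"
        unfolding r_def by (rule iffD2[OF pos_less_divide_eq, rotated]) (rule of_nat_0_less_iff[THEN iffD2, OF zero_less_Suc])
      have "of_int \<lfloor>x * real (Suc n)\<rfloor> + 1 \<le> x * real (Suc n) + 1" by linarith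
      then have "r n x \<le> (x * real (Suc n) + 1) / real (Suc n)"
        unfolding r_def by (rule divide_right_mono) (rule of_nat_0_le_iff)
      also have "\<dots> = x + 1 / real (Suc n)"
        by (simp add: add_divide_distrib del: of_nat_Suc)
      finally show "r n x \<le> x + 1 / real (Suc n)" .
    qed
    have "(\<lambda>n. x + 1 / real (Suc n)) \<longlonglongrightarrow> x + 0"
      by (intro tendsto_intros LIMSEQ_Suc[OF lim_1_over_n])
    then have "(\<lambda>n. x + 1 / real (Suc n)) \<longlonglongrightarrow> x"
      by simp
    then have "(\<lambda>n. r n x) \<longlonglongrightarrow> x"
    proof (rule tendsto_sandwich[OF _ _ tendsto_const, rotated 2])
      show "\<forall>\<^sub>F n in sequentially. x \<le> r n x"
        by (intro always_eventually allI less_imp_le less)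
      show "\<forall>\<^sub>F n in sequentially. r n x \<le> x + 1 / real (Suc n)"
        by (intro always_eventually allI le)
    qed
    moreover have "\<forall>\<^sub>F n in sequentially. x < r n x"
      by (intro always_eventually allI less)
    ultimately have "filterlim (\<lambda>n. r n x) (at_right x) sequentially"
      by (rule tendsto_imp_filterlim_at_right)
    moreover have "(f \<longlongrightarrow> f x) (at_right x)"
      using assms[of x] by (simp add: continuous_within)
    ultimately show "(\<lambda>n. f (r n x)) \<longlonglongrightarrow> f x"
      by (rule filterlim_compose[rotated])
  qed
qed

lemma \<W>_measurable:
  assumes "f \<in> \<W>"
  shows "f \<in> borel_measurable lebesgue"
proof -
  have "f \<in> borel_measurable borel"
    using assms by (intro borel_measurable_if_right_continuous) (simp add: \<W>_def)
  then show ?thesis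
    by (simp add: measurable_completion)
qed

section \<open>Windows and exceptional sets\<close>

text \<open>The product form absorbs the convention for radius 0 and is continuous in the radius, so
  that limits and sums of radii can be treated without a case distinction.\<close>

lemma mem_window_iff:
  assumes "0 \<le> \<epsilon>"
  shows "x \<in> window \<epsilon> \<longleftrightarrow> \<bar>x\<bar> * \<epsilon> \<le> 1"
proof (cases "\<epsilon> = 0")
  case False
  then have "\<bar>x\<bar> * \<epsilon> \<le> 1 \<longleftrightarrow> \<bar>x\<bar> \<le> 1 / \<epsilon>"
    using assms by (subst pos_le_divide_eq) auto
  then show ?thesis
    using False by (auto simp: window_def abs_le_iff)
qed (simp add: window_def)

lemma window_measurable [measurable]: "window \<epsilon> \<in> sets lebesgue"
  by (simp add: window_def)

definition deviation :: "(real \<Rightarrow> real) \<Rightarrow> (real \<Rightarrow> real) \<Rightarrow> real \<Rightarrow> real \<Rightarrow> real set" where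
  "deviation f g c \<epsilon> = {x \<in> window \<epsilon>. \<bar>f x - c - g x\<bar> > \<epsilon>}"

lemma mem_admissible_iff:
  "\<epsilon> \<in> admissible f g \<longleftrightarrow>
     0 \<le> \<epsilon> \<and> (\<exists>c. emeasure lebesgue (deviation f g c \<epsilon>) \<le> ennreal \<epsilon>)"
  by (simp add: admissible_def deviation_def)

lemma exceedance_measurable:
  fixes f g :: "'a::euclidean_space \<Rightarrow> real"
  assumes [measurable]: "f \<in> borel_measurable lebesgue" "g \<in> borel_measurable lebesgue"
  shows "{x. \<bar>f x - c - g x\<bar> > \<epsilon>} \<in> sets lebesgue"
proof -
  have "{x \<in> space lebesgue. \<bar>f x - c - g x\<bar> > \<epsilon>} \<in> sets lebesgue"
    by measurable
  then show ?thesis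
    by simp
qed

lemma deviation_measurable [measurable]:
  assumes "f \<in> borel_measurable lebesgue" "g \<in> borel_measurable lebesgue"
  shows "deviation f g c \<epsilon> \<in> sets lebesgue"
proof -
  have "deviation f g c \<epsilon> = window \<epsilon> \<inter> {x. \<bar>f x - c - g x\<bar> > \<epsilon>}"
    by (auto simp: deviation_def)
  then show ?thesis
    using window_measurable exceedance_measurable[OF assms] by (simp add: sets.Int)
qed

section \<open>Attainment of the minimum\<close>

text \<open>This is Fatou's lemma for indicators: on \<open>B\<close> the indicators of
  \<open>A n\<close> are eventually 1, so their liminf dominates the indicator of
  \<open>B\<close>.\<close>

lemma emeasure_le_if_eventually_mem:
  assumes [measurable]: "\<And>n. A n \<in> sets M" "B \<in> sets M"
    and le: "\<And>n. emeasure M (A n) \<le> e n" and lim: "e \<longlonglongrightarrow> l"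
    and mem: "\<And>x. x \<in> B \<Longrightarrow> \<forall>\<^sub>F n in sequentially. x \<in> A n"
  shows "emeasure M B \<le> l"
proof -
  have ind: "indicator B x \<le> liminf (\<lambda>n. indicator (A n) x :: ennreal)" for x
  proof (cases "x \<in> B")
    case True
    show ?thesis
      by (rule Liminf_bounded) (use mem[OF True] True in \<open>auto elim: eventually_mono\<close>)
  qed simp
  have "emeasure M B = (\<integral>\<^sup>+ x. indicator B x \<partial>M)"
    by simp
  also have "\<dots> \<le> (\<integral>\<^sup>+ x. liminf (\<lambda>n. indicator (A n) x) \<partial>M)"
    by (intro nn_integral_mono ind)
  also have "\<dots> \<le> liminf (\<lambda>n. \<integral>\<^sup>+ x. indicator (A n) x \<partial>M)"
    by (rule nn_integral_liminf) measurable
  also have "\<dots> \<le> liminf e"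
    by (intro Liminf_mono always_eventually) (simp add: le)
  also have "\<dots> = l"
    using lim by (simp add: lim_imp_Liminf)
  finally show ?thesis .
qed

lemma closed_admissible:
  assumes "f \<in> borel_measurable lebesgue" "g \<in> borel_measurable lebesgue"
  shows "closed (admissible f g)"
  unfolding closed_sequential_limits
proof safe
  fix e d assume adm: "\<forall>n. e n \<in> admissible f g" and lim: "e \<longlonglongrightarrow> d"
  have nonneg: "0 \<le> e n" for n
    using adm by (simp add: mem_admissible_iff)
  then have d: "0 \<le> d"
    using lim by (intro LIMSEQ_le_const) auto
  obtain c where c: "\<And>n. emeasure lebesgue (deviation f g (c n) (e n)) \<le> ennreal (e n)"
    using adm unfolding mem_admissible_iff by metis
  \<comment> \<open>The constants may be unbounded; compactness of the extended reals still yields a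
    limit \<open>l\<close>, possibly infinite.\<close>
  obtain l r where r: "strict_mono r" and l: "((\<lambda>n. ereal (c n)) \<circ> r) \<longlonglongrightarrow> l"
    using compact_complete_linorder[of "\<lambda>n. ereal (c n)"] by blast
  have er: "(\<lambda>n. e (r n)) \<longlonglongrightarrow> d"
    using LIMSEQ_subseq_LIMSEQ[OF lim r] by (simp add: comp_def)
  \<comment> \<open>For infinite \<open>l\<close> this is the default value 0, which is harmless:
    membership in the deviation sets then follows for every \<open>x\<close>, whatever
    \<open>c'\<close> is.\<close>
  define c' where "c' = real_of_ereal l"
  \<comment> \<open>Both inequalities are strict, so they survive a small change of the radius and
    the constant. The closed window is recovered below at the cost of its two endpoints.\<close>
  define B where "B = {x. \<bar>x\<bar> * d < 1 \<and> \<bar>f x - c' - g x\<bar> > d}"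
  have "open {x::real. \<bar>x\<bar> * d < 1}"
    by (intro open_Collect_less continuous_intros)
  then have "{x. \<bar>x\<bar> * d < 1} \<in> sets lebesgue"
    by simp
  then have "{x. \<bar>x\<bar> * d < 1} \<inter> {x. \<bar>f x - c' - g x\<bar> > d} \<in> sets lebesgue"
    by (intro sets.Int exceedance_measurable assms)
  then have B: "B \<in> sets lebesgue"
    by (simp add: B_def Int_def)
  have "emeasure lebesgue B \<le> ennreal d"
  proof (rule emeasure_le_if_eventually_mem[where A = "\<lambda>n. deviation f g (c (r n)) (e (r n))"
        and e = "\<lambda>n. ennreal (e (r n))"])
    show "deviation f g (c (r n)) (e (r n)) \<in> sets lebesgue" for n
      by (intro deviation_measurable assms)
    show "emeasure lebesgue (deviation f g (c (r n)) (e (r n))) \<le> ennreal (e (r n))" for n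
      by (rule c)
    show "(\<lambda>n. ennreal (e (r n))) \<longlonglongrightarrow> ennreal d"
      by (intro tendsto_ennrealI er)
    fix x assume x: "x \<in> B"
    have "(\<lambda>n. \<bar>x\<bar> * e (r n)) \<longlonglongrightarrow> \<bar>x\<bar> * d"
      by (intro tendsto_intros er)
    then have win: "\<forall>\<^sub>F n in sequentially. \<bar>x\<bar> * e (r n) < 1"
      by (rule order_tendstoD(2)) (use x in \<open>simp add: B_def\<close>)
    have "\<forall>\<^sub>F n in sequentially. e (r n) < \<bar>f x - c (r n) - g x\<bar>"
    proof (cases l)
      case (real a)
      then have "(\<lambda>n. c (r n)) \<longlonglongrightarrow> c'"
        using l by (simp add: comp_def c'_def)
      then have "(\<lambda>n. \<bar>f x - c (r n) - g x\<bar> - e (r n)) \<longlonglongrightarrow> \<bar>f x - c' - g x\<bar> - d"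
        by (intro tendsto_intros er)
      then have "\<forall>\<^sub>F n in sequentially. 0 < \<bar>f x - c (r n) - g x\<bar> - e (r n)"
        by (rule order_tendstoD(1)) (use x in \<open>simp add: B_def\<close>)
      then show ?thesis
        by eventually_elim simp
    next
      case PInf
      then have "\<forall>\<^sub>F n in sequentially. \<bar>f x - g x\<bar> + d + 1 < c (r n)"
        using l by (simp add: comp_def tendsto_PInfty)
      moreover have "\<forall>\<^sub>F n in sequentially. e (r n) < d + 1"
        using er by (rule order_tendstoD(2)) simp
      ultimately show ?thesis
        by eventually_elim linarith
    next
      case MInf
      then have "\<forall>\<^sub>F n in sequentially. c (r n) < - (\<bar>f x - g x\<bar> + d + 1)"
        using l by (simp add: comp_def tendsto_MInfty)
      moreover have "\<forall>\<^sub>F n in sequentially. e (r n) < d + 1"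
        using er by (rule order_tendstoD(2)) simp
      ultimately show ?thesis
        by eventually_elim linarith
    qed
    with win show "\<forall>\<^sub>F n in sequentially. x \<in> deviation f g (c (r n)) (e (r n))"
      by eventually_elim (simp add: deviation_def mem_window_iff nonneg)
  qed (rule B)
  moreover have "emeasure lebesgue (deviation f g c' d) \<le> emeasure lebesgue B"
  proof -
    \<comment> \<open>For \<open>d = 0\<close> the added set is just \<open>{0}\<close>, and no
      endpoint has to be covered, as \<open>\<bar>x\<bar> * d = 1\<close> is then
      impossible.\<close>
    have "deviation f g c' d \<subseteq> B \<union> {1 / d, - (1 / d)}"
    proof
      fix x assume x: "x \<in> deviation f g c' d"
      then have "\<bar>x\<bar> * d \<le> 1"
        by (simp add: deviation_def mem_window_iff d)
      moreover have "x \<in> {1 / d, - (1 / d)}" if "\<bar>x\<bar> * d = 1"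
      proof -
        have "\<bar>x\<bar> = 1 / d"
          using that by (metis mult_zero_right nonzero_eq_divide_eq zero_neq_one)
        then show ?thesis
          by (auto simp: abs_if split: if_splits)
      qed
      ultimately show "x \<in> B \<union> {1 / d, - (1 / d)}"
        using x by (auto simp: B_def deviation_def)
    qed
    then have "emeasure lebesgue (deviation f g c' d)
        \<le> emeasure lebesgue (B \<union> {1 / d, - (1 / d)})"
      by (intro emeasure_mono sets.Un B) auto
    also have "\<dots> \<le> emeasure lebesgue B + emeasure lebesgue {1 / d, - (1 / d)}"
      by (intro emeasure_subadditive B) auto
    also have "emeasure lebesgue {1 / d, - (1 / d)} = 0"
      by (intro null_setsD1 finite_imp_null_set_lborel[THEN null_sets_completionI]) auto
    finally show ?thesis
      by simp
  qed
  ultimately show "d \<in> admissible f g"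
    unfolding mem_admissible_iff using d order_trans by blast
qed

lemma bdd_below_admissible: "bdd_below (admissible f g)"
  by (rule bdd_belowI[of _ 0]) (simp add: mem_admissible_iff)

text \<open>The window of radius 2 is \<open>{-1/2..1/2}\<close>, of measure 1, so even a deviation
  on all of it is tolerated. This makes the set under the infimum nonempty for all
  functions.\<close>

lemma two_mem_admissible: "2 \<in> admissible f g"
proof -
  have "emeasure lebesgue (deviation f g 0 2) \<le> emeasure lebesgue (window 2)"
    by (rule emeasure_mono) (auto simp: deviation_def)
  also have "\<dots> \<le> ennreal 2"
    by (simp add: window_def)
  finally show ?thesis
    by (auto simp: mem_admissible_iff)
qed

lemma ab_dist_mem_admissible:
  assumes "f \<in> borel_measurable lebesgue" "g \<in> borel_measurable lebesgue"
  shows "ab_dist f g \<in> admissible f g"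
  unfolding ab_dist_def
  using two_mem_admissible
  by (intro closed_contains_Inf bdd_below_admissible closed_admissible assms) auto

lemma ab_dist_le: "\<epsilon> \<in> admissible f g \<Longrightarrow> ab_dist f g \<le> \<epsilon>"
  unfolding ab_dist_def by (intro cInf_lower bdd_below_admissible)

section \<open>Metric axioms\<close>

lemma ab_dist_nonneg: "0 \<le> ab_dist f g"
  unfolding ab_dist_def
proof (rule cInf_greatest)
  show "admissible f g \<noteq> {}"
    using two_mem_admissible by blast
qed (simp add: mem_admissible_iff)

text \<open>Exchanging the functions amounts to replacing the constant \<open>c\<close> by
  \<open>- c\<close>.\<close>

lemma ab_dist_commute: "ab_dist f g = ab_dist g f"
proof -
  have "deviation f g c \<epsilon> = deviation g f (- c) \<epsilon>" for f g :: "real \<Rightarrow> real" and c \<epsilon>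
    by (auto simp: deviation_def)
  then have "admissible f g = admissible g f"
    by (auto simp: mem_admissible_iff) metis+
  then show ?thesis
    by (simp add: ab_dist_def)
qed

text \<open>Since both minima are attained, their constants can be added. The window of
  \<open>a + b\<close> lies in the windows of \<open>a\<close> and of \<open>b\<close>, and a
  deviation above \<open>a + b\<close> forces one above \<open>a\<close> or one above
  \<open>b\<close>.\<close>

lemma ab_dist_triangle:
  assumes [measurable]: "f \<in> borel_measurable lebesgue" "g \<in> borel_measurable lebesgue"
    "h \<in> borel_measurable lebesgue"
  shows "ab_dist f h \<le> ab_dist f g + ab_dist g h"
proof (rule ab_dist_le)
  define a b where "a = ab_dist f g" and "b = ab_dist g h"
  obtain c c' where c: "emeasure lebesgue (deviation f g c a) \<le> ennreal a"
      "emeasure lebesgue (deviation g h c' b) \<le> ennreal b"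
    using ab_dist_mem_admissible assms unfolding a_def b_def mem_admissible_iff by meson
  have nonneg: "0 \<le> a" "0 \<le> b"
    by (simp_all add: a_def b_def ab_dist_nonneg)
  have "deviation f h (c + c') (a + b) \<subseteq> deviation f g c a \<union> deviation g h c' b"
  proof
    fix x assume x: "x \<in> deviation f h (c + c') (a + b)"
    then have "\<bar>x\<bar> * a + \<bar>x\<bar> * b \<le> 1"
      using nonneg by (simp add: deviation_def mem_window_iff distrib_left)
    moreover have "0 \<le> \<bar>x\<bar> * a" "0 \<le> \<bar>x\<bar> * b"
      using nonneg by simp_all
    ultimately have "\<bar>x\<bar> * a \<le> 1" "\<bar>x\<bar> * b \<le> 1"
      by linarith+
    then have "x \<in> window a" "x \<in> window b"
      using nonneg by (simp_all add: mem_window_iff)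
    moreover have "a < \<bar>f x - c - g x\<bar> \<or> b < \<bar>g x - c' - h x\<bar>"
      using x unfolding deviation_def by (auto simp: abs_if split: if_splits)
    ultimately show "x \<in> deviation f g c a \<union> deviation g h c' b"
      by (auto simp: deviation_def)
  qed
  then have "emeasure lebesgue (deviation f h (c + c') (a + b))
      \<le> emeasure lebesgue (deviation f g c a \<union> deviation g h c' b)"
    by (intro emeasure_mono) measurable
  also have "\<dots> \<le> emeasure lebesgue (deviation f g c a) + emeasure lebesgue (deviation g h c' b)"
    by (intro emeasure_subadditive) measurable
  also have "\<dots> \<le> ennreal a + ennreal b"
    by (intro add_mono c)
  also have "\<dots> = ennreal (a + b)"
    using nonneg by simp
  finally show "ab_dist f g + ab_dist g h \<in> admissible f h"
    using nonneg by (auto simp: mem_admissible_iff a_def b_def)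
qed

lemma ab_dist_self: "ab_dist f f = 0"
proof -
  have "deviation f f 0 0 = {}"
    by (simp add: deviation_def)
  then have "emeasure lebesgue (deviation f f 0 0) \<le> ennreal 0"
    by simp
  then have "0 \<in> admissible f f"
    unfolding mem_admissible_iff by blast
  then show ?thesis
    by (intro antisym ab_dist_le ab_dist_nonneg)
qed

text \<open>A nonzero value would persist on an interval to the right of \<open>x\<close>, which has
  positive measure.\<close>

lemma AE_zero_imp_zero_if_right_continuous:
  fixes f :: "real \<Rightarrow> real"
  assumes ae: "AE x in lebesgue. f x = 0" and cont: "continuous (at_right x) f"
  shows "f x = 0"
proof (rule ccontr)
  assume "f x \<noteq> 0"
  moreover have "(f \<longlongrightarrow> f x) (at_right x)"
    using cont by (simp add: continuous_within)
  ultimately have "\<forall>\<^sub>F y in at_right x. f y \<noteq> 0"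
    by (intro tendsto_imp_eventually_ne)
  then obtain b where b: "x < b" "\<And>y. x < y \<Longrightarrow> y < b \<Longrightarrow> f y \<noteq> 0"
    unfolding eventually_at_right_field by blast
  have "AE y in lebesgue. y \<notin> {x<..<b}"
    using ae by eventually_elim (use b in auto)
  then have "emeasure lebesgue {x<..<b} = 0"
    by (subst (asm) AE_iff_null_sets[symmetric]) auto
  then show False
    using b by simp
qed

lemma ab_dist_eq_0_imp_eq:
  assumes f: "f \<in> \<W>" and g: "g \<in> \<W>" and zero: "ab_dist f g = 0"
  shows "f = g"
proof -
  have [measurable]: "f \<in> borel_measurable lebesgue" "g \<in> borel_measurable lebesgue"
    using f g by (simp_all add: \<W>_measurable)
  have "0 \<in> admissible f g"
    using ab_dist_mem_admissible[of f g] zero by simp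
  then obtain c where c: "emeasure lebesgue (deviation f g c 0) = 0"
    by (auto simp: mem_admissible_iff)
  then have "deviation f g c 0 \<in> null_sets lebesgue"
    by (auto intro: null_setsI)
  \<comment> \<open>At radius 0 the window is the whole line and the threshold is 0, so the
    deviation set is exactly where \<open>f - c\<close> and \<open>g\<close> differ.\<close>
  then have "AE x in lebesgue. f x - c - g x = 0"
    by (rule AE_I') (auto simp: deviation_def window_def)
  then have eq: "f x - c - g x = 0" for x
    by (rule AE_zero_imp_zero_if_right_continuous)
      (use f g in \<open>auto simp: \<W>_def intro!: continuous_intros\<close>)
  \<comment> \<open>The constant difference \<open>c\<close> is identified by its limit at
    \<open>-\<infinity>\<close>.\<close>
  have "((\<lambda>x. f x - g x) \<longlongrightarrow> 0 - 0) at_bot"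
    using f g by (intro tendsto_diff) (simp_all add: \<W>_def)
  moreover have "(\<lambda>x. f x - g x) = (\<lambda>x. c)"
    using eq by (auto simp: fun_eq_iff algebra_simps)
  ultimately have "c = 0"
    by (simp add: tendsto_const_iff)
  with eq show ?thesis
    by auto
qed

section \<open>From metric convergence to almost basic convergence\<close>

lemma converges_almost_basically_if_ab_dist:
  assumes F: "\<And>n. F n \<in> borel_measurable lebesgue" and f: "f \<in> borel_measurable lebesgue"
    and lim: "(\<lambda>n. ab_dist (F n) f) \<longlonglongrightarrow> 0"
  shows "converges_almost_basically F f"
  unfolding converges_almost_basically_def
proof (intro allI impI)
  note [measurable] = F f
  fix k :: "nat \<Rightarrow> nat" assume k: "strict_mono k"
  have limk: "(\<lambda>n. ab_dist (F (k n)) f) \<longlonglongrightarrow> 0"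
    using LIMSEQ_subseq_LIMSEQ[OF lim k] by (simp add: comp_def)
  have "\<exists>l. strict_mono l \<and> (\<forall>n. ab_dist (F (k (l n))) f < (1/2) ^ n)"
  proof -
    have "\<exists>m. \<forall>j\<ge>m. ab_dist (F (k j)) f < (1/2) ^ n" for n :: nat
      using order_tendstoD(2)[OF limk, of "(1/2) ^ n"] by (simp add: eventually_sequentially)
    then obtain m where m: "\<And>n j. j \<ge> m n \<Longrightarrow> ab_dist (F (k j)) f < (1/2) ^ n"
      by metis
    \<comment> \<open>Partial sums of the positive numbers \<open>Suc (m i)\<close> are strictly
      increasing and dominate each \<open>m n\<close>.\<close>
    define l where "l n = (\<Sum>i\<le>n. Suc (m i))" for n
    have "strict_mono l"
      unfolding strict_mono_Suc_iff by (simp add: l_def)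
    moreover have "m n \<le> l n" for n
      unfolding l_def using member_le_sum[of n "{..n}" "\<lambda>i. Suc (m i)"] by simp
    ultimately show ?thesis
      using m by blast
  qed
  then obtain l where l: "strict_mono l" and less: "\<And>n. ab_dist (F (k (l n))) f < (1/2) ^ n"
    by blast
  define G where "G n = F (k (l n))" for n
  define d where "d n = ab_dist (G n) f" for n
  have G [measurable]: "G n \<in> borel_measurable lebesgue" for n
    by (simp add: G_def F)
  have d: "0 \<le> d n" "d n \<le> (1/2) ^ n" for n
    using less[of n] by (simp_all add: d_def G_def ab_dist_nonneg)
  have "d n \<in> admissible (G n) f" for n
    unfolding d_def by (intro ab_dist_mem_admissible G f)
  then obtain c where c: "\<And>n. emeasure lebesgue (deviation (G n) f (c n) (d n)) \<le> ennreal (d n)"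
    unfolding mem_admissible_iff by metis
  define A where "A n = deviation (G n) f (c n) (d n)" for n
  \<comment> \<open>Borel-Cantelli applies because the measures of the \<open>A n\<close> are
    bounded by the geometric sequence \<open>(1/2) ^ n\<close>.\<close>
  have "AE x in lebesgue. \<forall>\<^sub>F n in sequentially. x \<in> space lebesgue - A n"
  proof (rule borel_cantelli_AE1)
    show "A n \<in> sets lebesgue" for n
      unfolding A_def by measurable
    show "emeasure lebesgue (A n) < \<infinity>" for n
      using c[of n] by (simp add: A_def le_less_trans)
    have "measure lebesgue (A n) \<le> d n" for n
      using c[of n] d by (simp add: A_def measure_def enn2real_leI)
    then show "summable (\<lambda>n. measure lebesgue (A n))"
      using d by (intro summable_comparison_test'[OF summable_geometric[of "1/2 :: real"], where N=0])
        (auto intro: order_trans)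
  qed
  then obtain S where S: "S \<in> null_sets lebesgue"
      and "{x. \<not> (\<forall>\<^sub>F n in sequentially. x \<notin> A n)} \<subseteq> S"
    unfolding eventually_ae_filter by auto
  then have ev: "\<forall>\<^sub>F n in sequentially. x \<notin> A n" if "x \<notin> S" for x
    using that by blast
  have "d \<longlonglongrightarrow> 0"
    by (rule tendsto_sandwich[OF _ _ tendsto_const LIMSEQ_power_zero[of "1/2 :: real"]])
      (auto intro!: always_eventually d)
  have conv: "(\<lambda>n. G n x - c n) \<longlonglongrightarrow> f x" if x: "x \<notin> S" for x
  proof -
    \<comment> \<open>The windows grow to the whole line, so \<open>x\<close> eventually lies in
      them; avoiding \<open>A n\<close> then means that the deviation at \<open>x\<close> is at most
      \<open>d n\<close>.\<close>
    have "(\<lambda>n. \<bar>x\<bar> * d n) \<longlonglongrightarrow> \<bar>x\<bar> * 0"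
      by (intro tendsto_intros \<open>d \<longlonglongrightarrow> 0\<close>)
    then have "\<forall>\<^sub>F n in sequentially. \<bar>x\<bar> * d n < 1"
      by (rule order_tendstoD(2)) simp
    with ev[OF x] have "\<forall>\<^sub>F n in sequentially. norm (G n x - c n - f x) \<le> d n"
      by eventually_elim (auto simp: A_def deviation_def mem_window_iff d)
    then have "(\<lambda>n. G n x - c n - f x) \<longlonglongrightarrow> 0"
      using \<open>d \<longlonglongrightarrow> 0\<close> by (rule Lim_null_comparison)
    then show ?thesis
      by (simp add: LIM_zero_iff)
  qed
  have "(\<lambda>n. G n x - G n y) \<longlonglongrightarrow> f x - f y" if "x \<notin> S" "y \<notin> S" for x y
    using tendsto_diff[OF conv[OF that(1)] conv[OF that(2)]] by simp
  with S l show "\<exists>l. strict_mono l \<and> (\<exists>S\<in>null_sets lebesgue. \<forall>x1\<in>- S. \<forall>x2\<in>- S.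
      (\<lambda>i. F (k (l i)) x1 - F (k (l i)) x2) \<longlonglongrightarrow> f x1 - f x2)"
    unfolding G_def by (intro exI[of _ l] conjI bexI[of _ S]) auto
qed

section \<open>From almost basic convergence to metric convergence\<close>

lemma eventually_ab_dist_le:
  assumes [measurable]: "\<And>n. G n \<in> borel_measurable lebesgue" "f \<in> borel_measurable lebesgue"
    and S: "S \<in> null_sets lebesgue"
    and lim: "\<And>x y. x \<notin> S \<Longrightarrow> y \<notin> S \<Longrightarrow> (\<lambda>n. G n x - G n y) \<longlonglongrightarrow> f x - f y"
    and \<epsilon>: "0 < \<epsilon>"
  shows "\<forall>\<^sub>F n in sequentially. ab_dist (G n) f \<le> \<epsilon>"
proof -
  have "S \<noteq> UNIV"
    using S by (auto simp: null_sets_def)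
  then obtain z where z: "z \<notin> S"
    by blast
  \<comment> \<open>With this constant the deviation at \<open>x\<close> becomes
    \<open>(G n x - G n z) - (f x - f z)\<close>, which tends to 0 for \<open>x\<close> outside
    \<open>S\<close>.\<close>
  define A where "A n = deviation (G n) f (G n z - f z) \<epsilon>" for n
  have [measurable]: "A n \<in> sets lebesgue" for n
    unfolding A_def by measurable
  \<comment> \<open>Dominated convergence, with the indicator of the window as dominating function;
    its integral is finite because \<open>\<epsilon> > 0\<close> makes the window bounded.\<close>
  have "(\<lambda>n. \<integral>\<^sup>+x. indicator (A n) x \<partial>lebesgue) \<longlonglongrightarrow> (\<integral>\<^sup>+x. 0 \<partial>(lebesgue :: real measure))"
  proof (rule nn_integral_dominated_convergence[where w = "indicator (window \<epsilon>)"])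
    show "AE x in lebesgue. indicator (A n) x \<le> (indicator (window \<epsilon>) x :: ennreal)" for n
      by (auto simp: A_def deviation_def indicator_def)
    have "(\<integral>\<^sup>+ x. indicator (window \<epsilon>) x \<partial>lebesgue) = emeasure lebesgue (window \<epsilon>)"
      by (rule nn_integral_indicator) measurable
    then show "(\<integral>\<^sup>+ x. indicator (window \<epsilon>) x \<partial>lebesgue) < \<infinity>"
      using \<epsilon> by (simp add: window_def)
    have conv: "(\<lambda>n. indicator (A n) x) \<longlonglongrightarrow> (0::ennreal)" if x: "x \<notin> S" for x
    proof -
      have "(\<lambda>n. \<bar>(G n x - G n z) - (f x - f z)\<bar>) \<longlonglongrightarrow> \<bar>(f x - f z) - (f x - f z)\<bar>"
        by (intro tendsto_intros lim x z)
      then have "\<forall>\<^sub>F n in sequentially. \<bar>(G n x - G n z) - (f x - f z)\<bar> < \<epsilon>"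
        by (rule order_tendstoD(2)) (simp add: \<epsilon>)
      then have "\<forall>\<^sub>F n in sequentially. indicator (A n) x = (0::ennreal)"
        by eventually_elim (auto simp: A_def deviation_def algebra_simps)
      then show ?thesis
        by (rule tendsto_eventually)
    qed
    show "AE x in lebesgue. (\<lambda>n. indicator (A n) x) \<longlonglongrightarrow> (0::ennreal)"
      using S by (rule AE_I') (use conv in auto)
  qed measurable
  then have "(\<lambda>n. emeasure lebesgue (A n)) \<longlonglongrightarrow> 0"
    by simp
  then have "\<forall>\<^sub>F n in sequentially. emeasure lebesgue (A n) < ennreal \<epsilon>"
    by (rule order_tendstoD(2)) (simp add: \<epsilon>)
  then show ?thesis
  proof eventually_elim
    case (elim n)
    then have "\<epsilon> \<in> admissible (G n) f"
      using \<epsilon> unfolding mem_admissible_iff A_def by (blast intro: less_imp_le)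
    then show ?case
      by (rule ab_dist_le)
  qed
qed

text \<open>Otherwise the distances stay above some \<open>\<epsilon> > 0\<close> along a
  subsequence, yet a further subsequence of it converges off a null set and so has distances that
  are eventually small.\<close>

lemma ab_dist_tendsto_0_if_converges_almost_basically:
  assumes F: "\<And>n. F n \<in> borel_measurable lebesgue" and f: "f \<in> borel_measurable lebesgue"
    and conv: "converges_almost_basically F f"
  shows "(\<lambda>n. ab_dist (F n) f) \<longlonglongrightarrow> 0"
proof (rule ccontr)
  assume "\<not> ?thesis"
  then obtain \<epsilon> where \<epsilon>: "0 < \<epsilon>" and "\<not> (\<forall>\<^sub>F n in sequentially. ab_dist (F n) f < \<epsilon>)"
    unfolding tendsto_iff by (auto simp: ab_dist_nonneg)
  then have inf: "infinite {n. ab_dist (F n) f \<ge> \<epsilon>}"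
    by (simp add: frequently_cofinite[symmetric] cofinite_eq_sequentially frequently_def not_le)
  define k where "k = enumerate {n. ab_dist (F n) f \<ge> \<epsilon>}"
  have k: "strict_mono k" "\<And>n. \<epsilon> \<le> ab_dist (F (k n)) f"
    using enumerate_in_set[OF inf] strict_mono_enumerate[OF inf] by (auto simp: k_def)
  obtain l S where S: "S \<in> null_sets lebesgue"
    and lim: "\<forall>x\<in>- S. \<forall>y\<in>- S. (\<lambda>i. F (k (l i)) x - F (k (l i)) y) \<longlonglongrightarrow> f x - f y"
    using conv k(1) unfolding converges_almost_basically_def by blast
  \<comment> \<open>Halving \<open>\<epsilon>\<close> turns the non-strict bound into a
    contradiction with \<open>\<epsilon> \<le> ab_dist (F (k n)) f\<close>.\<close>
  have "\<forall>\<^sub>F n in sequentially. ab_dist (F (k (l n))) f \<le> \<epsilon> / 2"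
    by (rule eventually_ab_dist_le[of "\<lambda>n. F (k (l n))", OF F f S])
      (use lim \<epsilon> in simp_all)
  then obtain n where "ab_dist (F (k (l n))) f \<le> \<epsilon> / 2"
    by (auto simp: eventually_sequentially)
  with k(2)[of "l n"] \<epsilon> show False
    by simp
qed

theorem lemma3p4:
  shows "(\<forall>f\<in>\<W>. \<forall>g\<in>\<W>. ab_dist f g \<in> admissible f g \<and>
            (\<forall>\<epsilon>\<in>admissible f g. ab_dist f g \<le> \<epsilon>)) \<and>
         Metric_space \<W> ab_dist \<and>
         (\<forall>F f. (\<forall>n. F n \<in> \<W>) \<longrightarrow> f \<in> \<W> \<longrightarrow>
            ((\<lambda>n. ab_dist (F n) f) \<longlonglongrightarrow> 0 \<longleftrightarrow> converges_almost_basically F f))"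
proof (intro conjI allI impI ballI)
  show "Metric_space \<W> ab_dist"
    using ab_dist_nonneg ab_dist_commute ab_dist_self ab_dist_eq_0_imp_eq
      ab_dist_triangle[OF \<W>_measurable \<W>_measurable \<W>_measurable]
    by unfold_locales auto
next
  fix F :: "nat \<Rightarrow> real \<Rightarrow> real" and f assume "\<forall>n. F n \<in> \<W>" "f \<in> \<W>"
  then show "(\<lambda>n. ab_dist (F n) f) \<longlonglongrightarrow> 0 \<longleftrightarrow> converges_almost_basically F f"
    using converges_almost_basically_if_ab_dist ab_dist_tendsto_0_if_converges_almost_basically
      \<W>_measurable by metis
qed (simp_all add: ab_dist_mem_admissible \<W>_measurable ab_dist_le)

end
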